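(* Let $Z$ be a finite set, let $\Theta=\Theta_s\times\Theta_g$ be a parameter set, and fix a query $x$ and an answer $y$. For each $\theta_s\in\Theta_s$ let $p(z\mid x;\theta_s)$ be a probability mass function of $z\in Z$, and for each $z\in Z$, $\theta_g\in\Theta_g$ let $p(y\mid x,d_z;\theta_g)\in[0,1]$. For $\theta=(\theta_s,\theta_g)\in\Theta$ put $p(y,z\mid x;\theta)=p(z\mid x;\theta_s)\,p(y\mid x,d_z;\theta_g)$ and $p(y\mid x;\theta)=\sum_{z\in Z}p(y,z\mid x;\theta)$. Let $(\theta^t)_{t\ge 1}$, $\theta^t=(\theta_s^t,\theta_g^t)$, be a sequence in $\Theta$ with $p(y\mid x;\theta^t)>0$ for all $t\ge1$, such that for every $t\ge 1$ $$\theta^{t+1}\in\arg\max_{\theta\in\Theta}\ \mathbb{E}_{z\sim p(z\mid x;\theta_s^{t})}\bigl[w_t(z)\log p(y,z\mid x;\theta)\bigr],\qquad w_t(z)=\frac{p(z\mid x,y;\theta^{t})}{p(z\mid x;\theta_s^{t})},$$ where $p(z\mid x,y;\theta^t)=p(y,z\mid x;\theta^t)/p(y\mid x;\theta^t)$. Then $$\log p(y\mid x;\theta^{t+1})\ \ge\ \log p(y\mid x;\theta^{t})\qquad\text{for all } t\ge 1,$$ and the sequence $\bigl(\log p(y\mid x;\theta^{t})\bigr)_{t\ge1}$ converges to a finite limit.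
   Context: $Z$ is the finite set of document permutations (ordered selections of documents from a finite candidate list), and $d_z$ denotes the documents selected by $z\in Z$. The parameter $\theta_s$ parametrizes a selection model giving a distribution over $Z$, and $\theta_g$ parametrizes a generator giving the probability of the answer $y$ from $x$ and $d_z$. The expectation is the finite sum over those $z$ with $p(z\mid x;\theta_s^t)>0$, with the conventions $\log 0=-\infty$ and $0\cdot(-\infty)=0$. *)

theory Defs
  imports "HOL-Probability.Probability_Mass_Function"
begin

text \<open>Natural logarithm of a probability, with \<open>log 0 = -\<infinity>\<close>. The other convention,
  \<open>0 \<cdot> (-\<infinity>) = 0\<close>, is built into multiplication on \<^typ>\<open>ereal\<close>.\<close>

definition elog :: "real \<Rightarrow> ereal" where
  "elog u = (if u = 0 then -\<infinity> else ereal (ln u))"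

text \<open>
  Throughout, \<open>sel x \<theta>\<^sub>s\<close> is the selection distribution \<open>p(\<cdot> | x; \<theta>\<^sub>s)\<close>, \<open>gen x d \<theta>\<^sub>g y\<close> is the
  generator probability \<open>p(y | x, d; \<theta>\<^sub>g)\<close>, \<open>doc z\<close> are the documents \<open>d\<^sub>z\<close> selected by \<open>z\<close>,
  and a parameter is a pair \<open>\<theta> = (\<theta>\<^sub>s, \<theta>\<^sub>g)\<close>.
\<close>

definition joint ::
  "('x \<Rightarrow> 's \<Rightarrow> 'z pmf) \<Rightarrow> ('x \<Rightarrow> 'd \<Rightarrow> 'g \<Rightarrow> 'y \<Rightarrow> real) \<Rightarrow> ('z \<Rightarrow> 'd)
    \<Rightarrow> 'x \<Rightarrow> 'y \<Rightarrow> 's \<times> 'g \<Rightarrow> 'z \<Rightarrow> real" where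
  "joint sel gen doc x y \<theta> z = pmf (sel x (fst \<theta>)) z * gen x (doc z) (snd \<theta>) y"

definition marginal ::
  "'z set \<Rightarrow> ('x \<Rightarrow> 's \<Rightarrow> 'z pmf) \<Rightarrow> ('x \<Rightarrow> 'd \<Rightarrow> 'g \<Rightarrow> 'y \<Rightarrow> real) \<Rightarrow> ('z \<Rightarrow> 'd)
    \<Rightarrow> 'x \<Rightarrow> 'y \<Rightarrow> 's \<times> 'g \<Rightarrow> real" where
  "marginal Z sel gen doc x y \<theta> = (\<Sum>z\<in>Z. joint sel gen doc x y \<theta> z)"

definition posterior ::
  "'z set \<Rightarrow> ('x \<Rightarrow> 's \<Rightarrow> 'z pmf) \<Rightarrow> ('x \<Rightarrow> 'd \<Rightarrow> 'g \<Rightarrow> 'y \<Rightarrow> real) \<Rightarrow> ('z \<Rightarrow> 'd)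
    \<Rightarrow> 'x \<Rightarrow> 'y \<Rightarrow> 's \<times> 'g \<Rightarrow> 'z \<Rightarrow> real" where
  "posterior Z sel gen doc x y \<theta> z = joint sel gen doc x y \<theta> z / marginal Z sel gen doc x y \<theta>"

definition weight ::
  "'z set \<Rightarrow> ('x \<Rightarrow> 's \<Rightarrow> 'z pmf) \<Rightarrow> ('x \<Rightarrow> 'd \<Rightarrow> 'g \<Rightarrow> 'y \<Rightarrow> real) \<Rightarrow> ('z \<Rightarrow> 'd)
    \<Rightarrow> 'x \<Rightarrow> 'y \<Rightarrow> 's \<times> 'g \<Rightarrow> 'z \<Rightarrow> real" where
  "weight Z sel gen doc x y \<theta> z = posterior Z sel gen doc x y \<theta> z / pmf (sel x (fst \<theta>)) z"

text \<open>Expectation of an extended-real function under a distribution on the finite set \<open>Z\<close>,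
  summed over the points of positive probability only.\<close>

definition expect :: "'z set \<Rightarrow> 'z pmf \<Rightarrow> ('z \<Rightarrow> ereal) \<Rightarrow> ereal" where
  "expect Z P f = (\<Sum>z\<in>{z\<in>Z. pmf P z > 0}. ereal (pmf P z) * f z)"

text \<open>The objective maximised over \<open>\<theta>\<close>, at the current iterate \<open>\<theta>'\<close>.\<close>

definition objective ::
  "'z set \<Rightarrow> ('x \<Rightarrow> 's \<Rightarrow> 'z pmf) \<Rightarrow> ('x \<Rightarrow> 'd \<Rightarrow> 'g \<Rightarrow> 'y \<Rightarrow> real) \<Rightarrow> ('z \<Rightarrow> 'd)
    \<Rightarrow> 'x \<Rightarrow> 'y \<Rightarrow> 's \<times> 'g \<Rightarrow> 's \<times> 'g \<Rightarrow> ereal" where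
  "objective Z sel gen doc x y \<theta>' \<theta> =
     expect Z (sel x (fst \<theta>'))
       (\<lambda>z. ereal (weight Z sel gen doc x y \<theta>' z) * elog (joint sel gen doc x y \<theta> z))"

end

theory Submission
  imports Defs
begin

text \<open>
  Multiplying by \<open>p(z | x; \<theta>\<^sub>s\<^sup>t)\<close> cancels the denominator of the weight, so the objective is the EM
  surrogate \<open>\<Sum>\<^sub>z p(z | x, y; \<theta>\<^sup>t) log p(y, z | x; \<theta>)\<close>. It is finite at \<open>\<theta>\<^sup>t\<close>, hence finite at the
  maximiser, and the concavity of the logarithm turns an increase of the surrogate into an increase
  of the marginal likelihood. The likelihood is at most 1, so its logarithm converges.
\<close>

text \<open>This is Gibbs' inequality for unnormalised weights: apply
  \<open>ln u \<le> u - 1\<close> to the ratio of \<open>b z\<close> to the rescaled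
  \<open>a z\<close>, weight by \<open>a z\<close> and sum. The bound \<open>B\<close> is kept apart
  from \<open>sum b S\<close> so that it can also count mass lying outside \<open>S\<close>.\<close>

lemma ln_sum_le_of_cross_entropy_le:
  fixes a b :: "'a \<Rightarrow> real"
  assumes fin: "finite S" and a: "\<And>z. z \<in> S \<Longrightarrow> a z > 0" and b: "\<And>z. z \<in> S \<Longrightarrow> b z > 0"
    and A: "sum a S > 0" and B: "sum b S \<le> B"
    and le: "(\<Sum>z\<in>S. a z * ln (a z)) \<le> (\<Sum>z\<in>S. a z * ln (b z))"
  shows "ln (sum a S) \<le> ln B"
proof -
  \<comment> \<open>Scaling \<open>a\<close> by \<open>c\<close> gives it total mass
    \<open>B\<close>, so the linear upper bounds below sum to at most \<open>0\<close>. The goal is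
    then just \<open>ln c \<ge> 0\<close>.\<close>
  define c where "c = B / sum a S"
  have "S \<noteq> {}" using A by auto
  then have "sum b S > 0" using fin b by (intro sum_pos)
  then have Bpos: "B > 0" using B by simp
  then have c: "c > 0" using A by (simp add: c_def)
  have "a z * (ln (b z) - ln (a z) - ln c) \<le> b z / c - a z" if z: "z \<in> S" for z
  proof -
    have "ln (b z) - ln (a z) - ln c = ln (b z / (a z * c))"
      using a[OF z] b[OF z] c by (simp add: ln_div ln_mult)
    also have "\<dots> \<le> b z / (a z * c) - 1"
      using a[OF z] b[OF z] c by (intro ln_le_minus_one) simp
    finally have "a z * (ln (b z) - ln (a z) - ln c) \<le> a z * (b z / (a z * c) - 1)"
      using a[OF z] by (intro mult_left_mono) auto
    also have "\<dots> = b z / c - a z"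
      using a[OF z] c by (simp add: right_diff_distrib)
    finally show ?thesis .
  qed
  then have "(\<Sum>z\<in>S. a z * (ln (b z) - ln (a z) - ln c)) \<le> (\<Sum>z\<in>S. b z / c - a z)"
    by (rule sum_mono)
  also have "\<dots> = sum b S / c - sum a S"
    by (simp add: sum_subtractf sum_divide_distrib)
  also have "\<dots> \<le> B / c - sum a S"
    using B c by (simp add: divide_right_mono)
  also have "\<dots> = 0" using A Bpos by (simp add: c_def)
  finally have "(\<Sum>z\<in>S. a z * ln (b z)) - (\<Sum>z\<in>S. a z * ln (a z)) - sum a S * ln c \<le> 0"
    by (simp add: right_diff_distrib sum_subtractf sum_distrib_right)
  then have "0 \<le> sum a S * ln c" using le by linarith
  then have "0 \<le> ln c" using A by (simp add: zero_le_mult_iff)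
  then show ?thesis using A Bpos by (simp add: c_def ln_div)
qed

lemma sum_ereal_mult_elog:
  assumes "\<And>z. z \<in> S \<Longrightarrow> b z > 0"
  shows "(\<Sum>z\<in>S. ereal (q z) * elog (b z)) = ereal (\<Sum>z\<in>S. q z * ln (b z))"
proof -
  have "(\<Sum>z\<in>S. ereal (q z) * elog (b z)) = (\<Sum>z\<in>S. ereal (q z * ln (b z)))"
    using assms by (intro sum.cong) (force simp: elog_def)+
  then show ?thesis by simp
qed

text \<open>The term at \<open>z0\<close> is a positive multiple of \<open>elog 0\<close>, and
  nothing can cancel it because \<open>elog\<close> never takes the value
  \<open>\<infinity>\<close>.\<close>

lemma sum_ereal_mult_elog_eq_MInfty:
  assumes fin: "finite S" and q: "\<And>z. z \<in> S \<Longrightarrow> q z > 0" and z0: "z0 \<in> S" "b z0 = 0"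
  shows "(\<Sum>z\<in>S. ereal (q z) * elog (b z)) = -\<infinity>"
proof -
  \<comment> \<open>The remaining terms may well include \<open>-\<infinity>\<close>; only
    \<open>\<infinity>\<close> has to be excluded.\<close>
  have "(\<Sum>z\<in>S - {z0}. ereal (q z) * elog (b z)) \<noteq> \<infinity>"
    using fin by (auto simp: sum_Pinfty elog_def dest: q)
  moreover have "ereal (q z0) * elog (b z0) = -\<infinity>"
    using q[of z0] z0 by (simp add: elog_def)
  moreover have "(\<Sum>z\<in>S. ereal (q z) * elog (b z)) =
      ereal (q z0) * elog (b z0) + (\<Sum>z\<in>S - {z0}. ereal (q z) * elog (b z))"
    using fin z0(1) by (rule sum.remove)
  ultimately show ?thesis by (metis MInfty_neq_PInfty(1) ereal_plus_eq_MInfty)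
qed

text \<open>Restricting the sum to the support of the joint at \<open>\<theta>'\<close> makes every
  coefficient strictly positive once the marginal is, so that a vanishing joint at
  \<open>\<theta>\<close> is visible as \<open>-\<infinity>\<close>.\<close>

lemma objective_eq_sum_posterior:
  assumes fin: "finite Z" and nonneg: "\<And>z. z \<in> Z \<Longrightarrow> gen x (doc z) (snd \<theta>') y \<ge> 0"
  shows "objective Z sel gen doc x y \<theta>' \<theta> =
    (\<Sum>z\<in>{z\<in>Z. joint sel gen doc x y \<theta>' z > 0}.
      ereal (posterior Z sel gen doc x y \<theta>' z) * elog (joint sel gen doc x y \<theta> z))"
proof -
  let ?p = "pmf (sel x (fst \<theta>'))"
  have "objective Z sel gen doc x y \<theta>' \<theta> =
    (\<Sum>z\<in>{z\<in>Z. ?p z > 0}.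
      ereal (posterior Z sel gen doc x y \<theta>' z) * elog (joint sel gen doc x y \<theta> z))"
    unfolding objective_def expect_def
  proof (rule sum.cong)
    fix z assume "z \<in> {z\<in>Z. ?p z > 0}"
    then have "ereal (?p z) * ereal (weight Z sel gen doc x y \<theta>' z)
        = ereal (posterior Z sel gen doc x y \<theta>' z)"
      by (simp add: weight_def)
    then show "ereal (?p z) * (ereal (weight Z sel gen doc x y \<theta>' z) * elog (joint sel gen doc x y \<theta> z))
        = ereal (posterior Z sel gen doc x y \<theta>' z) * elog (joint sel gen doc x y \<theta> z)"
      by (metis mult.assoc)
  qed simp
  also have "\<dots> = (\<Sum>z\<in>{z\<in>Z. joint sel gen doc x y \<theta>' z > 0}.
      ereal (posterior Z sel gen doc x y \<theta>' z) * elog (joint sel gen doc x y \<theta> z))"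
  proof (rule sum.mono_neutral_right)
    show "{z\<in>Z. joint sel gen doc x y \<theta>' z > 0} \<subseteq> {z\<in>Z. ?p z > 0}"
      using nonneg by (auto simp: joint_def zero_less_mult_iff dest: leD)
    \<comment> \<open>At the dropped points the joint at \<open>\<theta>'\<close> is
      \<open>0\<close>, hence so is the posterior, and the term vanishes even where
      \<open>elog\<close> is \<open>-\<infinity>\<close>.\<close>
    show "\<forall>z\<in>{z\<in>Z. ?p z > 0} - {z\<in>Z. joint sel gen doc x y \<theta>' z > 0}.
        ereal (posterior Z sel gen doc x y \<theta>' z) * elog (joint sel gen doc x y \<theta> z) = 0"
    proof
      fix z assume "z \<in> {z\<in>Z. ?p z > 0} - {z\<in>Z. joint sel gen doc x y \<theta>' z > 0}"
      moreover from this have "joint sel gen doc x y \<theta>' z \<ge> 0"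
        using nonneg by (auto simp: joint_def)
      ultimately show "ereal (posterior Z sel gen doc x y \<theta>' z) * elog (joint sel gen doc x y \<theta> z) = 0"
        by (simp add: posterior_def)
    qed
  qed (use fin in auto)
  finally show ?thesis .
qed

text \<open>One EM step: positivity of both joints on the support at \<open>\<theta>'\<close>
  reduces the comparison of objectives to real sums, where the Gibbs-type inequality
  applies.\<close>

lemma ln_marginal_mono_of_objective:
  assumes fin: "finite Z"
    and nonneg': "\<And>z. z \<in> Z \<Longrightarrow> gen x (doc z) (snd \<theta>') y \<ge> 0"
    and nonneg: "\<And>z. z \<in> Z \<Longrightarrow> gen x (doc z) (snd \<theta>) y \<ge> 0"
    and pos: "marginal Z sel gen doc x y \<theta>' > 0"
    and le: "objective Z sel gen doc x y \<theta>' \<theta>' \<le> objective Z sel gen doc x y \<theta>' \<theta>"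
  shows "ln (marginal Z sel gen doc x y \<theta>') \<le> ln (marginal Z sel gen doc x y \<theta>)"
proof -
  define a where "a = joint sel gen doc x y \<theta>'"
  define b where "b = joint sel gen doc x y \<theta>"
  define S where "S = {z\<in>Z. a z > 0}"
  define q where "q = posterior Z sel gen doc x y \<theta>'"
  let ?A = "marginal Z sel gen doc x y \<theta>'"
  have S: "finite S" "S \<subseteq> Z" using fin by (auto simp: S_def)
  have a: "a z > 0" if "z \<in> S" for z using that by (simp add: S_def)
  have b0: "b z \<ge> 0" if "z \<in> Z" for z using nonneg[OF that] by (simp add: b_def joint_def)
  have a0: "a z \<ge> 0" if "z \<in> Z" for z using nonneg'[OF that] by (simp add: a_def joint_def)
  have qa: "q z = a z / ?A" for z by (simp add: q_def posterior_def a_def)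
  have q: "q z > 0" if "z \<in> S" for z using a[OF that] pos by (simp add: qa)
  have A: "?A = sum a S"
    unfolding marginal_def a_def[symmetric] S_def
    using fin a0 by (intro sum.mono_neutral_right) (auto simp: not_less intro: antisym)
  \<comment> \<open>Only an inequality holds here, since \<open>\<theta>\<close> may put joint mass
    outside the support \<open>S\<close> belonging to \<open>\<theta>'\<close>.\<close>
  have B: "sum b S \<le> marginal Z sel gen doc x y \<theta>"
    unfolding marginal_def b_def[symmetric] using fin S b0 by (intro sum_mono2) auto
  have obj: "objective Z sel gen doc x y \<theta>' \<theta>'' =
      (\<Sum>z\<in>S. ereal (q z) * elog (joint sel gen doc x y \<theta>'' z))" for \<theta>''
    unfolding S_def a_def q_def using fin nonneg' by (rule objective_eq_sum_posterior)
  have obj_a: "objective Z sel gen doc x y \<theta>' \<theta>' = ereal (\<Sum>z\<in>S. q z * ln (a z))"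
    unfolding obj a_def[symmetric] using a by (rule sum_ereal_mult_elog)
  \<comment> \<open>A zero of \<open>b\<close> in \<open>S\<close> would send the objective at
    \<open>\<theta>\<close> to \<open>-\<infinity>\<close>, below its finite value at
    \<open>\<theta>'\<close>.\<close>
  have b: "b z > 0" if z: "z \<in> S" for z
  proof (rule ccontr)
    assume "\<not> b z > 0"
    then have "b z = 0" using b0[of z] z S by auto
    then have "objective Z sel gen doc x y \<theta>' \<theta> = -\<infinity>"
      unfolding obj b_def[symmetric] using S q z by (intro sum_ereal_mult_elog_eq_MInfty)
    then show False using le obj_a by simp
  qed
  have "objective Z sel gen doc x y \<theta>' \<theta> = ereal (\<Sum>z\<in>S. q z * ln (b z))"
    unfolding obj b_def[symmetric] using b by (rule sum_ereal_mult_elog)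
  \<comment> \<open>The posterior is \<open>a z / ?A\<close>, so the positive factor
    \<open>1 / ?A\<close> comes out of both sums.\<close>
  then have "(\<Sum>z\<in>S. a z * ln (a z)) / ?A \<le> (\<Sum>z\<in>S. a z * ln (b z)) / ?A"
    using le obj_a by (simp add: qa sum_divide_distrib)
  then have "(\<Sum>z\<in>S. a z * ln (a z)) \<le> (\<Sum>z\<in>S. a z * ln (b z))"
    using pos by (simp add: divide_le_cancel)
  then show ?thesis
    using ln_sum_le_of_cross_entropy_le[of S a b] S a b pos B unfolding A by blast
qed

lemma marginal_le_1:
  assumes "finite Z" and "\<And>z. z \<in> Z \<Longrightarrow> gen x (doc z) (snd \<theta>) y \<le> 1"
  shows "marginal Z sel gen doc x y \<theta> \<le> 1"
proof -
  let ?P = "sel x (fst \<theta>)"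
  have "marginal Z sel gen doc x y \<theta> \<le> sum (pmf ?P) Z"
    unfolding marginal_def joint_def using assms(2)
    by (intro sum_mono) (simp add: mult_left_le)
  also have "\<dots> = measure (measure_pmf ?P) Z"
    using assms(1) by (simp add: measure_measure_pmf_finite)
  also have "\<dots> \<le> 1" by simp
  finally show ?thesis .
qed

theorem mainTheorem2:
  fixes Z :: "'z set" and \<Theta>s :: "'s set" and \<Theta>g :: "'g set"
    and sel :: "'x \<Rightarrow> 's \<Rightarrow> 'z pmf" and gen :: "'x \<Rightarrow> 'd \<Rightarrow> 'g \<Rightarrow> 'y \<Rightarrow> real"
    and doc :: "'z \<Rightarrow> 'd" and x :: 'x and y :: 'y
    and \<theta> :: "nat \<Rightarrow> 's \<times> 'g"
  assumes "finite Z"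
    and "\<And>\<theta>s. \<theta>s \<in> \<Theta>s \<Longrightarrow> set_pmf (sel x \<theta>s) \<subseteq> Z"
    and "\<And>z \<theta>g. z \<in> Z \<Longrightarrow> \<theta>g \<in> \<Theta>g \<Longrightarrow> gen x (doc z) \<theta>g y \<in> {0..1}"
    and "\<And>t. t \<ge> 1 \<Longrightarrow> \<theta> t \<in> \<Theta>s \<times> \<Theta>g"
    and "\<And>t. t \<ge> 1 \<Longrightarrow> marginal Z sel gen doc x y (\<theta> t) > 0"
    and "\<And>t. t \<ge> 1 \<Longrightarrow>
      is_arg_max (objective Z sel gen doc x y (\<theta> t)) (\<lambda>\<theta>'. \<theta>' \<in> \<Theta>s \<times> \<Theta>g) (\<theta> (Suc t))"
  shows "(\<forall>t\<ge>1. elog (marginal Z sel gen doc x y (\<theta> (Suc t)))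
                 \<ge> elog (marginal Z sel gen doc x y (\<theta> t)))
    \<and> (\<exists>L::real. (\<lambda>t. elog (marginal Z sel gen doc x y (\<theta> t))) \<longlonglongrightarrow> ereal L)"
proof -
  let ?m = "\<lambda>t. marginal Z sel gen doc x y (\<theta> t)"
  have gen: "gen x (doc z) (snd (\<theta> t)) y \<in> {0..1}" if "z \<in> Z" "t \<ge> 1" for z t
    using assms(3)[OF that(1)] assms(4)[OF that(2)] by (auto simp: mem_Times_iff)
  have mono: "ln (?m t) \<le> ln (?m (Suc t))" if t: "t \<ge> 1" for t
  proof (rule ln_marginal_mono_of_objective)
    show "objective Z sel gen doc x y (\<theta> t) (\<theta> t)
        \<le> objective Z sel gen doc x y (\<theta> t) (\<theta> (Suc t))"
      \<comment> \<open>\<open>is_arg_max\<close> says that no feasible point is strictly better; it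
        is applied to the feasible point \<open>\<theta> t\<close>, and linearity of the order gives
        \<open>\<le>\<close>.\<close>
      using assms(6)[OF t] assms(4)[OF t] unfolding is_arg_max_def by (meson not_less)
  qed (use assms(1) assms(5)[OF t] gen t in auto)
  have elog: "elog (?m t) = ereal (ln (?m t))" if "t \<ge> 1" for t
    using assms(5)[OF that] by (simp add: elog_def)
  have "?m t \<le> 1" if "t \<ge> 1" for t
    using assms(1) gen that by (intro marginal_le_1) auto
  \<comment> \<open>The hypotheses start at index 1, so monotone convergence is applied to the
    shifted sequence; \<open>LIMSEQ_imp_Suc\<close> undoes the shift at the end.\<close>
  then have "\<forall>t. ln (?m (Suc t)) \<le> 0" using assms(5) by simp
  moreover have "incseq (\<lambda>t. ln (?m (Suc t)))" by (rule incseq_SucI) (simp add: mono)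
  ultimately obtain L where "(\<lambda>t. ln (?m (Suc t))) \<longlonglongrightarrow> L"
    using incseq_convergent by blast
  then have "(\<lambda>t. elog (?m (Suc t))) \<longlonglongrightarrow> ereal L" by (simp add: elog)
  then have "(\<lambda>t. elog (?m t)) \<longlonglongrightarrow> ereal L" by (rule LIMSEQ_imp_Suc)
  then show ?thesis using mono elog by auto
qed

end
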